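(* Let $D=d_1,\ldots,d_n$ and $F=f_1,\ldots,f_n$ be a pair of degree and neighbor degree sequences (sequences of positive integers), and let $\Delta$ be the largest degree in $D$. Then $(D,F)$ is multigraph realizable if and only if the following integer programming feasibility problem $(\mathcal{X},\mathcal{L})$ has a solution. The indeterminates $\mathcal{X}$ are the variables $x_\lambda$ for all partitions $\lambda=\lambda_1,\ldots,\lambda_{h(\lambda)}$ with $h(\lambda)\le\Delta$ and $\lambda_i\le\Delta$ for all $i$, together with auxiliary variables $p_1,\ldots,p_\Delta$. The system $\mathcal{L}$ consists of - for all positive integers $d,f$: $\ \sum_{\lambda\dashv f\,\wedge\,h(\lambda)=d}x_\lambda=y_{d,f}$, and $x_\lambda\ge 0$ for all $\lambda$, where $y_{d,f}$ is the number of indices $i$ with $d_i=d$ and $f_i=f$; - for all $0<i<j\le\Delta$: $\ \sum_{\lambda|h(\lambda)=i}x_\lambda N(\lambda,j)=\sum_{\lambda'|h(\lambda')=j}x_{\lambda'}N(\lambda',i)$; - for all $1\le i\le\Delta$: $\ \sum_{\lambda|h(\lambda)=i}x_\lambda N(\lambda,i)=2p_i$.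
   Context: $(D,F)$ is multigraph realizable if there is a multigraph (loops and parallel edges allowed) on vertices $v_1,\ldots,v_n$ such that for all $k$, $d(v_k)=d_k$ and $\sum_{w\in\mathcal{N}(v_k)}d(w)=f_k$, where $d(v)$ is the degree and $\mathcal{N}(v)$ the neighbors of $v$, counted with multiplicity (one term for each half-edge at $v$; a loop at $v$ contributes $2$ to $d(v)$ and $2d(v)$ to the sum). An integer programming feasibility problem $(\mathcal{X},\mathcal{L})$ asks whether there is an integer assignment to the indeterminates $\mathcal{X}$ satisfying the system $\mathcal{L}$ of linear equations and inequalities. $\lambda\dashv f$ means that $\lambda$ is a partition of $f$ (a multiset of positive integers with sum $f$); its height $h(\lambda)$ is its number of parts; $N(\lambda,j)$ is the number of parts equal to $j$. All sums over $\lambda$ range over partitions $\lambda$ whose variable $x_\lambda$ is in $\mathcal{X}$; an empty sum is $0$. *)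

theory Defs
  imports Main "HOL-Library.Multiset" "HOL-Library.Uprod"
begin

(* A multigraph on a vertex set V is a finite multiset of unordered pairs over V. The pair
   Upair v v is a loop; edges of multiplicity at least two are parallel. *)

definition multigraph_on :: "'a set \<Rightarrow> 'a uprod multiset \<Rightarrow> bool" where
  "multigraph_on V G \<longleftrightarrow> (\<forall>e \<in># G. set_uprod e \<subseteq> V)"

lift_definition edge_ends :: "'a uprod \<Rightarrow> 'a multiset" is "\<lambda>(a, b). {#a, b#}"
  by (auto simp: eq_upair_def add_mset_commute)

(* One entry for each half-edge of e at v, namely the vertex at the opposite end of e. *)
lift_definition opposite_ends :: "'a \<Rightarrow> 'a uprod \<Rightarrow> 'a multiset" is
  "\<lambda>v (a, b). (if a = v then {#b#} else {#}) + (if b = v then {#a#} else {#})"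
  by (auto simp: eq_upair_def add_mset_commute)

definition degree :: "'a uprod multiset \<Rightarrow> 'a \<Rightarrow> nat" where
  "degree G v = (\<Sum>e \<in># G. count (edge_ends e) v)"

definition neighbors :: "'a uprod multiset \<Rightarrow> 'a \<Rightarrow> 'a multiset" where
  "neighbors G v = (\<Sum>e \<in># G. opposite_ends v e)"

lemma degree_loop: "degree {#Upair v v#} v = 2"
  by (simp add: degree_def edge_ends.abs_eq Upair.abs_eq)

lemma neighbors_loop: "neighbors {#Upair v v#} v = {#v, v#}"
  by (simp add: neighbors_def opposite_ends.abs_eq Upair.abs_eq)

(* Sequences are lists and the vertex with index k is the number k, counted from 0. *)
definition multigraph_realizable :: "nat list \<Rightarrow> nat list \<Rightarrow> bool" where
  "multigraph_realizable D F \<longleftrightarrow>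
     (\<exists>G. multigraph_on {..<length D} G \<and>
          (\<forall>k < length D. degree G k = D ! k \<and> (\<Sum>w \<in># neighbors G k. degree G w) = F ! k))"

definition partition_of :: "nat multiset \<Rightarrow> nat \<Rightarrow> bool" (infix "\<stileturn>" 50) where
  "\<mu> \<stileturn> f \<longleftrightarrow> 0 \<notin># \<mu> \<and> \<Sum>\<^sub># \<mu> = f" for \<mu> :: "nat multiset"

(* The height of a partition is its size, and N(mu, j) is count mu j. *)

definition bounded_partitions :: "nat \<Rightarrow> nat multiset set" where
  "bounded_partitions \<Delta> =
     {\<mu>. (\<exists>f. \<mu> \<stileturn> f) \<and> size \<mu> \<le> \<Delta> \<and> (\<forall>i \<in># \<mu>. i \<le> \<Delta>)}"

definition pair_count :: "nat list \<Rightarrow> nat list \<Rightarrow> nat \<Rightarrow> nat \<Rightarrow> nat" where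
  "pair_count D F d f = card {i. i < length D \<and> D ! i = d \<and> F ! i = f}"

(* The indeterminates are x mu for mu in bounded_partitions Delta and p i for
   1 <= i <= Delta; values of x and p at other arguments do not occur in the system. *)
definition ip_solution ::
  "nat list \<Rightarrow> nat list \<Rightarrow> (nat multiset \<Rightarrow> int) \<Rightarrow> (nat \<Rightarrow> int) \<Rightarrow> bool" where
  "ip_solution D F x p \<longleftrightarrow> (let \<Delta> = Max (set D); X = bounded_partitions \<Delta> in
     (\<forall>d>0. \<forall>f>0.
        (\<Sum>\<mu> | \<mu> \<in> X \<and> \<mu> \<stileturn> f \<and> size \<mu> = d. x \<mu>) = int (pair_count D F d f)) \<and>
     (\<forall>\<mu> \<in> X. x \<mu> \<ge> 0) \<and>
     (\<forall>i j. 0 < i \<and> i < j \<and> j \<le> \<Delta> \<longrightarrow>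
        (\<Sum>\<mu> | \<mu> \<in> X \<and> size \<mu> = i. x \<mu> * int (count \<mu> j)) =
        (\<Sum>\<mu>' | \<mu>' \<in> X \<and> size \<mu>' = j. x \<mu>' * int (count \<mu>' i))) \<and>
     (\<forall>i. 1 \<le> i \<and> i \<le> \<Delta> \<longrightarrow>
        (\<Sum>\<mu> | \<mu> \<in> X \<and> size \<mu> = i. x \<mu> * int (count \<mu> i)) = 2 * p i))"

(* Guards against sums over infinite index sets, which would be 0 by convention. *)
lemma finite_bounded_partitions: "finite (bounded_partitions \<Delta>)"
proof (rule finite_subset)
  show "bounded_partitions \<Delta> \<subseteq> mset ` {xs. set xs \<subseteq> {..\<Delta>} \<and> length xs \<le> \<Delta>}"
  proof
    fix \<mu> assume *: "\<mu> \<in> bounded_partitions \<Delta>"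
    obtain xs where "\<mu> = mset xs" by (metis ex_mset)
    with * show "\<mu> \<in> mset ` {xs. set xs \<subseteq> {..\<Delta>} \<and> length xs \<le> \<Delta>}"
      by (auto simp: bounded_partitions_def)
  qed
  show "finite (mset ` {xs. set xs \<subseteq> {..\<Delta>} \<and> length xs \<le> \<Delta>})"
    by (intro finite_imageI finite_lists_length_le) simp
qed

end

theory Submission
  imports Defs
begin

text \<open>
  Colour every vertex by its degree, and call the multiset of the colours of its neighbors the
  demand of the vertex. A realization of \<open>(D, F)\<close> amounts to a choice of demands: the vertex
  \<open>k\<close> needs a demand with \<open>D ! k\<close> parts and sum \<open>F ! k\<close>, that is, a partition of
  \<open>F ! k\<close> of height \<open>D ! k\<close>. Since the system sees only how often each partition is used,
  the variable \<open>x \<mu>\<close> is the number of vertices with demand \<open>\<mu>\<close>.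

  It remains to see which demands come from a multigraph. Counting half-edges from colour \<open>i\<close>
  to colour \<open>j\<close> in both directions gives the symmetry condition, and inside one colour
  the half-edges come in pairs, which gives the parity condition. Conversely, because loops and
  parallel edges are allowed, these conditions suffice (\<open>realizable_demands_iff\<close>): any
  two unserved half-edges that ask for each other's colours may be joined, and this preserves
  both conditions.

  Passing from a solution of the system back to demands is a distribution of the vertices
  with given \<open>(D ! k, F ! k)\<close> among the partitions of that height and sum, in the prescribed
  numbers (\<open>exists_labelling_with_fibre_cards\<close>).
\<close>

section \<open>Demands that are realized by a multigraph\<close>

text \<open>
  Here \<open>count (\<mu> v) j\<close> stands for a number of half-edges at \<open>v\<close> leading to
  vertices of colour \<open>j\<close>, whether read off a multigraph or only prescribed.
\<close>

definition half_edges :: "('a \<Rightarrow> 'c) \<Rightarrow> 'a set \<Rightarrow> ('a \<Rightarrow> 'c multiset) \<Rightarrow> 'c \<Rightarrow> 'c \<Rightarrow> nat" where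
  "half_edges col V \<mu> i j = (\<Sum>v | v \<in> V \<and> col v = i. count (\<mu> v) j)"

definition balanced :: "('a \<Rightarrow> 'c) \<Rightarrow> 'a set \<Rightarrow> ('a \<Rightarrow> 'c multiset) \<Rightarrow> bool" where
  "balanced col V \<mu> \<longleftrightarrow>
     (\<forall>i j. half_edges col V \<mu> i j = half_edges col V \<mu> j i) \<and> (\<forall>i. even (half_edges col V \<mu> i i))"

lemma half_edges_add:
  "half_edges col V (\<lambda>v. \<mu> v + \<nu> v) i j = half_edges col V \<mu> i j + half_edges col V \<nu> i j"
  by (simp add: half_edges_def sum.distrib)

lemma half_edges_cong:
  "(\<And>v. v \<in> V \<Longrightarrow> \<mu> v = \<nu> v) \<Longrightarrow> half_edges col V \<mu> i j = half_edges col V \<nu> i j"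
  by (auto simp: half_edges_def intro!: sum.cong)

lemma half_edges_pos_iff:
  "finite V \<Longrightarrow> half_edges col V \<mu> i j > 0 \<longleftrightarrow> (\<exists>v \<in> V. col v = i \<and> j \<in># \<mu> v)"
  unfolding half_edges_def neq0_conv[symmetric] by (auto simp: count_eq_zero_iff)

lemma balanced_cong:
  assumes "\<And>v. v \<in> V \<Longrightarrow> \<mu> v = \<nu> v"
  shows "balanced col V \<mu> \<longleftrightarrow> balanced col V \<nu>"
  unfolding balanced_def using half_edges_cong[OF assms, of V] by simp

lemma opposite_ends_Upair:
  "opposite_ends v (Upair a b) =
     (if a = v then {#b#} else {#}) + (if b = v then {#a#} else {#})"
  by (simp add: opposite_ends.abs_eq Upair.abs_eq)

lemma edge_ends_Upair: "edge_ends (Upair a b) = {#a, b#}"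
  by (simp add: edge_ends.abs_eq Upair.abs_eq)

lemma half_edges_single:
  assumes "finite V" "a \<in> V"
  shows "half_edges col V (\<lambda>v. if a = v then {#c#} else {#}) i j = of_bool (col a = i \<and> c = j)"
proof -
  have "half_edges col V (\<lambda>v. if a = v then {#c#} else {#}) i j =
        (\<Sum>v | v \<in> V \<and> col v = i. if v = a then of_bool (c = j) else 0)"
    unfolding half_edges_def by (rule sum.cong) auto
  also have "\<dots> = of_bool (col a = i \<and> c = j)"
    using assms by simp
  finally show ?thesis .
qed

lemma half_edges_edge:
  assumes "finite V" "a \<in> V" "b \<in> V"
  shows "half_edges col V (\<lambda>v. image_mset col (opposite_ends v (Upair a b))) i j =
         of_bool (col a = i \<and> col b = j) + of_bool (col b = i \<and> col a = j)"
proof -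
  have *: "(\<lambda>v. image_mset col (opposite_ends v (Upair a b))) =
     (\<lambda>v. (if a = v then {#col b#} else {#}) + (if b = v then {#col a#} else {#}))"
    by (auto simp: opposite_ends_Upair fun_eq_iff)
  show ?thesis
    unfolding * half_edges_add using assms by (simp add: half_edges_single)
qed

text \<open>
  An edge contributes symmetrically to the half-edge counts, and an even number to each diagonal
  entry, so adding or deleting an edge does not affect balance. Adding edges one by one to the
  empty multigraph shows that balance is necessary; removing the contribution of a suitable edge
  from given demands is the induction step for its sufficiency.
\<close>

lemma balanced_add_edge_iff:
  assumes "finite V" "a \<in> V" "b \<in> V"
  shows "balanced col V (\<lambda>v. image_mset col (opposite_ends v (Upair a b)) + \<mu> v)
         \<longleftrightarrow> balanced col V \<mu>"
proof -
  have "half_edges col V (\<lambda>v. image_mset col (opposite_ends v (Upair a b)) + \<mu> v) i j =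
     of_bool (col a = i \<and> col b = j) + of_bool (col b = i \<and> col a = j) + half_edges col V \<mu> i j"
    for i j
    by (simp add: half_edges_add half_edges_edge assms)
  then show ?thesis
    unfolding balanced_def by (simp add: conj_commute add.commute)
qed

lemma neighbors_add_edge: "neighbors (add_mset e G) v = opposite_ends v e + neighbors G v"
  by (simp add: neighbors_def)

lemma balanced_neighbors:
  assumes "finite V" "multigraph_on V G"
  shows "balanced col V (\<lambda>v. image_mset col (neighbors G v))"
  using assms(2)
proof (induction G)
  case empty
  show ?case by (simp add: balanced_def half_edges_def neighbors_def)
next
  case (add e G)
  obtain a b where "e = Upair a b" by (cases e) auto
  then show ?case
    using add assms(1) by (simp add: multigraph_on_def neighbors_add_edge balanced_add_edge_iff)
qed

text \<open>
  Serving one half-edge of \<open>k\<close> towards colour \<open>j\<close> leaves the vertices of colour \<open>j\<close>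
  with an unserved half-edge towards the colour of \<open>k\<close>: for different colours by symmetry, and for
  equal colours since an even positive count is at least two. The partner \<open>l\<close> may be
  \<open>k\<close> itself, and then the new edge is a loop.
\<close>

lemma balanced_imp_removable_edge:
  assumes V: "finite V" and bal: "balanced col V \<mu>" and k: "k \<in> V" and j: "j \<in># \<mu> k"
  obtains l \<nu> where "l \<in> V"
    "\<And>v. \<mu> v = image_mset col (opposite_ends v (Upair k l)) + \<nu> v"
proof -
  define \<mu>1 where "\<mu>1 = (\<lambda>v. if k = v then \<mu> v - {#j#} else \<mu> v)"
  have \<mu>: "\<mu> v = (if k = v then {#j#} else {#}) + \<mu>1 v" for v
    using j by (auto simp: \<mu>1_def)
  have count: "half_edges col V \<mu> a b = of_bool (col k = a \<and> j = b) + half_edges col V \<mu>1 a b" for a b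
    using half_edges_add[of col V "\<lambda>v. if k = v then {#j#} else {#}" \<mu>1 a b]
    by (simp add: half_edges_single V k \<mu>[symmetric])
  have "half_edges col V \<mu>1 j (col k) > 0"
  proof (cases "j = col k")
    case True
    have "even (half_edges col V \<mu> j j)"
      using bal by (simp add: balanced_def)
    then show ?thesis using count[of j j] True by (auto intro: gr0I)
  next
    case False
    have "half_edges col V \<mu> j (col k) = half_edges col V \<mu> (col k) j"
      using bal by (simp add: balanced_def)
    then show ?thesis using count[of j "col k"] count[of "col k" j] False by simp
  qed
  then obtain l where l: "l \<in> V" "col l = j" "col k \<in># \<mu>1 l"
    using half_edges_pos_iff[OF V] by metis
  define \<nu> where "\<nu> = (\<lambda>v. if l = v then \<mu>1 v - {#col k#} else \<mu>1 v)"
  have "\<mu>1 v = (if l = v then {#col k#} else {#}) + \<nu> v" for v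
    using l by (auto simp: \<nu>_def)
  then have "\<mu> v = image_mset col (opposite_ends v (Upair k l)) + \<nu> v" for v
    using \<mu>[of v] l by (auto simp: opposite_ends_Upair)
  with l(1) show thesis by (rule that)
qed

lemma balanced_imp_realizable:
  assumes "finite V" "balanced col V \<mu>"
  shows "\<exists>G. multigraph_on V G \<and> (\<forall>v \<in> V. image_mset col (neighbors G v) = \<mu> v)"
  using assms(2)
proof (induction "\<Sum>v\<in>V. size (\<mu> v)" arbitrary: \<mu> rule: less_induct)
  case less
  show ?case
  proof (cases "\<forall>v\<in>V. \<mu> v = {#}")
    case True
    then show ?thesis
      by (intro exI[of _ "{#}"]) (simp add: multigraph_on_def neighbors_def)
  next
    case False
    then obtain k j where k: "k \<in> V" "j \<in># \<mu> k"
      by (meson multiset_nonemptyE)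
    obtain l \<nu> where l: "l \<in> V"
      and \<mu>: "\<And>v. \<mu> v = image_mset col (opposite_ends v (Upair k l)) + \<nu> v"
      using balanced_imp_removable_edge[OF assms(1) less.prems k] by metis
    have "balanced col V \<nu>"
      using less.prems balanced_add_edge_iff[OF assms(1) k(1) l, of col \<nu>]
      by (simp add: \<mu>[symmetric])
    moreover have "(\<Sum>v\<in>V. size (\<nu> v)) < (\<Sum>v\<in>V. size (\<mu> v))"
    proof (rule sum_strict_mono_ex1)
      show "finite V" by (fact assms(1))
      show "\<forall>v\<in>V. size (\<nu> v) \<le> size (\<mu> v)" by (simp add: \<mu>)
      show "\<exists>v\<in>V. size (\<nu> v) < size (\<mu> v)"
        using k(1) by (intro bexI[of _ k]) (simp_all add: \<mu> opposite_ends_Upair)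
    qed
    ultimately obtain G where G: "multigraph_on V G"
      "\<forall>v \<in> V. image_mset col (neighbors G v) = \<nu> v"
      using less.hyps by blast
    show ?thesis
      using G k(1) l
      by (intro exI[of _ "add_mset (Upair k l) G"])
        (simp add: multigraph_on_def neighbors_add_edge \<mu>)
  qed
qed

theorem realizable_demands_iff:
  assumes "finite V"
  shows "(\<exists>G. multigraph_on V G \<and> (\<forall>v \<in> V. image_mset col (neighbors G v) = \<mu> v))
         \<longleftrightarrow> balanced col V \<mu>"
  using balanced_imp_realizable[OF assms] balanced_neighbors[OF assms]
    balanced_cong[of V _ \<mu> col] by metis

section \<open>Realizations as balanced families of partitions\<close>

lemma size_neighbors: "size (neighbors G v) = degree G v"
proof (induction G)
  case empty
  show ?case by (simp add: neighbors_def degree_def)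
next
  case (add e G)
  have "size (opposite_ends v e) = count (edge_ends e) v"
    by (cases e) (auto simp: opposite_ends_Upair edge_ends_Upair)
  with add show ?case by (simp add: neighbors_def degree_def)
qed

lemma set_neighbors_subset: "multigraph_on V G \<Longrightarrow> set_mset (neighbors G v) \<subseteq> V"
proof (induction G)
  case empty
  show ?case by (simp add: neighbors_def)
next
  case (add e G)
  obtain a b where "e = Upair a b" by (cases e) auto
  with add show ?case
    by (auto simp: neighbors_add_edge opposite_ends_Upair multigraph_on_def split: if_splits)
qed

text \<open>
  The colour of a vertex is its prescribed degree \<open>D ! k\<close>. In the backward direction the actual
  degrees agree with the colours because a demand has as many parts as its vertex has
  half-edges.
\<close>

lemma multigraph_realizable_iff_balanced:
  "multigraph_realizable D F \<longleftrightarrow>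
     (\<exists>\<mu>. (\<forall>k < length D. size (\<mu> k) = D ! k \<and> \<Sum>\<^sub># (\<mu> k) = F ! k \<and> set_mset (\<mu> k) \<subseteq> set D) \<and>
          balanced ((!) D) {..<length D} \<mu>)"
  (is "_ \<longleftrightarrow> (\<exists>\<mu>. ?fits \<mu> \<and> ?bal \<mu>)")
proof
  let ?V = "{..<length D}"
  assume "multigraph_realizable D F"
  then obtain G where G: "multigraph_on ?V G"
    and deg: "\<And>k. k < length D \<Longrightarrow> degree G k = D ! k"
    and sum: "\<And>k. k < length D \<Longrightarrow> (\<Sum>w \<in># neighbors G k. degree G w) = F ! k"
    unfolding multigraph_realizable_def by blast
  define \<mu> where "\<mu> k = image_mset ((!) D) (neighbors G k)" for k
  have "\<mu> k = image_mset (degree G) (neighbors G k)" for k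
    unfolding \<mu>_def using set_neighbors_subset[OF G, of k] deg
    by (intro image_mset_cong) auto
  then have "\<Sum>\<^sub># (\<mu> k) = F ! k" if "k < length D" for k
    using sum[OF that] by simp
  moreover have "size (\<mu> k) = D ! k" if "k < length D" for k
    using deg[OF that] by (simp add: \<mu>_def size_neighbors)
  moreover have "set_mset (\<mu> k) \<subseteq> set D" for k
    using set_neighbors_subset[OF G, of k] by (auto simp: \<mu>_def)
  moreover have "?bal \<mu>"
    unfolding \<mu>_def using G by (simp add: balanced_neighbors)
  ultimately show "\<exists>\<mu>. ?fits \<mu> \<and> ?bal \<mu>" by blast
next
  let ?V = "{..<length D}"
  assume "\<exists>\<mu>. ?fits \<mu> \<and> ?bal \<mu>"
  then obtain \<mu> where fits: "?fits \<mu>" and "?bal \<mu>" by blast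
  then obtain G where G: "multigraph_on ?V G"
    and nb: "\<And>k. k < length D \<Longrightarrow> image_mset ((!) D) (neighbors G k) = \<mu> k"
    using realizable_demands_iff[of ?V "(!) D" \<mu>] by auto
  have deg: "degree G k = D ! k" if "k < length D" for k
    using fits that nb[OF that] by (metis size_image_mset size_neighbors)
  have "image_mset (degree G) (neighbors G k) = \<mu> k" if "k < length D" for k
    unfolding nb[OF that, symmetric] using set_neighbors_subset[OF G, of k] deg
    by (intro image_mset_cong) auto
  then show "multigraph_realizable D F"
    unfolding multigraph_realizable_def using G deg fits by auto
qed

section \<open>Families of partitions and their multiplicities\<close>

text \<open>
  Elements of \<open>M\<close> serve as labels, each usable only on elements with the same key. Handling
  one label \<open>m\<close> after the other, any \<open>c m\<close> of the still unlabelled elements with its key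
  can receive it: the hypothesis guarantees that there are enough of them, and it persists for
  the rest.
\<close>

lemma exists_labelling_with_fibre_cards:
  fixes c :: "'m \<Rightarrow> nat"
  assumes "finite M" "finite A"
    and "\<And>y. (\<Sum>m | m \<in> M \<and> key m = y. c m) = card {a \<in> A. key' a = y}"
  shows "\<exists>g. (\<forall>a \<in> A. g a \<in> M \<and> key (g a) = key' a) \<and> (\<forall>m \<in> M. card {a \<in> A. g a = m} = c m)"
  using assms
proof (induction M arbitrary: A rule: finite_induct)
  case empty
  then have "{a \<in> A. key' a = y} = {}" for y by simp
  then have "A = {}" by auto
  then show ?case by simp
next
  case (insert m M)
  have split: "(\<Sum>m' | m' \<in> insert m M \<and> key m' = y. c m') =
      (if key m = y then c m else 0) + (\<Sum>m' | m' \<in> M \<and> key m' = y. c m')" for y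
  proof -
    have "{m' \<in> insert m M. key m' = y} =
        (if key m = y then insert m {m' \<in> M. key m' = y} else {m' \<in> M. key m' = y})"
      by auto
    then show ?thesis using insert.hyps by simp
  qed
  have "c m \<le> card {a \<in> A. key' a = key m}"
    using insert.prems(2)[of "key m"] split[of "key m"] by simp
  then obtain B where B: "B \<subseteq> {a \<in> A. key' a = key m}" "card B = c m"
    using obtain_subset_with_card_n by metis
  then have "finite B" using insert.prems(1) by (auto intro: finite_subset)
  have "(\<Sum>m' | m' \<in> M \<and> key m' = y. c m') = card {a \<in> A - B. key' a = y}" for y
  proof -
    have "{a \<in> A - B. key' a = y} = {a \<in> A. key' a = y} - (if key m = y then B else {})"
      using B(1) by auto
    then have "card {a \<in> A - B. key' a = y} =
        card {a \<in> A. key' a = y} - (if key m = y then c m else 0)"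
      using B \<open>finite B\<close> by (auto simp: card_Diff_subset)
    then show ?thesis using insert.prems(2)[of y] split[of y] by simp
  qed
  then obtain g where g: "\<forall>a \<in> A - B. g a \<in> M \<and> key (g a) = key' a"
    "\<forall>m \<in> M. card {a \<in> A - B. g a = m} = c m"
    using insert.IH[of "A - B"] insert.prems(1) by auto
  define h where "h a = (if a \<in> B then m else g a)" for a
  have "{a \<in> A. h a = m} = B"
    using B(1) g(1) insert.hyps by (auto simp: h_def)
  moreover have "{a \<in> A. h a = m'} = {a \<in> A - B. g a = m'}" if "m' \<in> M" for m'
    using that insert.hyps by (auto simp: h_def)
  ultimately have "\<forall>m' \<in> insert m M. card {a \<in> A. h a = m'} = c m'"
    using B(2) g(2) by auto
  moreover have "\<forall>a \<in> A. h a \<in> insert m M \<and> key (h a) = key' a"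
    using B(1) g(1) by (auto simp: h_def)
  ultimately show ?case by blast
qed

text \<open>
  Grouping the vertices of degree \<open>i\<close> by their demand turns a half-edge count into the linear
  form in the multiplicities that appears in the integer program. No equation of the program
  constrains \<open>x {#}\<close>, so \<open>x\<close> is tied to multiplicities at nonempty partitions only.
\<close>

lemma half_edges_eq_sum_partitions:
  assumes "finite X" "finite V" "i > 0"
    and fits: "\<And>k. k \<in> V \<Longrightarrow> \<mu> k \<in> X \<and> size (\<mu> k) = col k"
    and x: "\<And>m. m \<in> X \<Longrightarrow> m \<noteq> {#} \<Longrightarrow> x m = int (card {k \<in> V. \<mu> k = m})"
  shows "(\<Sum>m | m \<in> X \<and> size m = i. x m * int (count m j)) = int (half_edges col V \<mu> i j)"
proof -
  have "int (half_edges col V \<mu> i j) = (\<Sum>k | k \<in> V \<and> col k = i. int (count (\<mu> k) j))"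
    by (simp add: half_edges_def)
  also have "\<dots> = (\<Sum>m | m \<in> X \<and> size m = i.
      \<Sum>k | k \<in> {k. k \<in> V \<and> col k = i} \<and> \<mu> k = m. int (count (\<mu> k) j))"
    using assms(1,2) fits by (intro sum.group[symmetric]) auto
  also have "\<dots> = (\<Sum>m | m \<in> X \<and> size m = i. x m * int (count m j))"
  proof (rule sum.cong[OF refl])
    fix m assume m: "m \<in> {m. m \<in> X \<and> size m = i}"
    then have nonempty: "m \<noteq> {#}" using assms(3) by auto
    have "{k. k \<in> {k. k \<in> V \<and> col k = i} \<and> \<mu> k = m} = {k \<in> V. \<mu> k = m}"
      using m fits by auto
    then show "(\<Sum>k | k \<in> {k. k \<in> V \<and> col k = i} \<and> \<mu> k = m. int (count (\<mu> k) j)) =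
        x m * int (count m j)"
      using m x[OF _ nonempty] by simp
  qed
  finally show ?thesis by simp
qed

lemma balanced_imp_ip_solution:
  assumes pos: "\<forall>k < length D. D ! k > 0"
    and fits: "\<forall>k < length D. size (\<mu> k) = D ! k \<and> \<Sum>\<^sub># (\<mu> k) = F ! k \<and> set_mset (\<mu> k) \<subseteq> set D"
    and bal: "balanced ((!) D) {..<length D} \<mu>"
  shows "\<exists>x p. ip_solution D F x p"
proof -
  let ?V = "{..<length D}"
  let ?X = "bounded_partitions (Max (set D))"
  let ?h = "half_edges ((!) D) ?V \<mu>"
  define x where "x m = int (card {k \<in> ?V. \<mu> k = m})" for m
  define p where "p i = int (?h i i div 2)" for i
  have in_X: "\<mu> k \<in> ?X" if "k < length D" for k
  proof -
    have "0 \<notin> set D" using pos by (auto simp: in_set_conv_nth)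
    moreover have "D ! k \<le> Max (set D)" using that by simp
    ultimately show ?thesis
      using fits that by (auto simp: bounded_partitions_def partition_of_def intro!: Max_ge)
  qed
  have part: "\<mu> k \<stileturn> f \<longleftrightarrow> F ! k = f" if "k < length D" for k f
    using in_X[OF that] fits that by (auto simp: bounded_partitions_def partition_of_def)
  have lin: "(\<Sum>m | m \<in> ?X \<and> size m = i. x m * int (count m j)) = int (?h i j)" if "i > 0" for i j
    using that in_X fits by (intro half_edges_eq_sum_partitions)
      (auto simp: x_def finite_bounded_partitions)
  have "(\<Sum>m | m \<in> ?X \<and> m \<stileturn> f \<and> size m = d. x m) = int (pair_count D F d f)" for d f
  proof -
    let ?M = "{m. m \<in> ?X \<and> m \<stileturn> f \<and> size m = d}" and ?A = "{i. i < length D \<and> D ! i = d \<and> F ! i = f}"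
    have "pair_count D F d f = (\<Sum>k\<in>?A. 1)" by (simp add: pair_count_def)
    also have "\<dots> = (\<Sum>m\<in>?M. \<Sum>k | k \<in> ?A \<and> \<mu> k = m. 1)"
      using in_X fits part by (intro sum.group[symmetric]) (auto simp: finite_bounded_partitions)
    also have "\<dots> = (\<Sum>m\<in>?M. card {k \<in> ?V. \<mu> k = m})"
      using fits part by (intro sum.cong) (auto intro!: arg_cong[where f = card])
    finally show ?thesis by (simp add: x_def)
  qed
  moreover have "\<forall>m\<in>?X. x m \<ge> 0" by (simp add: x_def)
  moreover have "int (?h i j) = int (?h j i)" for i j
    using bal by (simp add: balanced_def)
  moreover have "int (?h i i) = 2 * p i" for i
  proof -
    have "?h i i = 2 * (?h i i div 2)" using bal by (simp add: balanced_def)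
    then show ?thesis unfolding p_def by linarith
  qed
  ultimately have "ip_solution D F x p"
    unfolding ip_solution_def Let_def by (auto simp: lin)
  then show ?thesis by blast
qed

lemma ip_solution_imp_balanced:
  assumes pos: "\<forall>k < length D. D ! k > 0" "\<forall>k < length D. F ! k > 0"
    and sol: "ip_solution D F x p"
  shows "\<exists>\<mu>. (\<forall>k < length D. size (\<mu> k) = D ! k \<and> \<Sum>\<^sub># (\<mu> k) = F ! k \<and> set_mset (\<mu> k) \<subseteq> set D) \<and>
             balanced ((!) D) {..<length D} \<mu>"
proof -
  let ?V = "{..<length D}"
  let ?\<Delta> = "Max (set D)"
  let ?X = "bounded_partitions ?\<Delta>"
  have total: "\<And>d f. d > 0 \<Longrightarrow> f > 0 \<Longrightarrow>
        (\<Sum>m | m \<in> ?X \<and> m \<stileturn> f \<and> size m = d. x m) = int (pair_count D F d f)"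
    and nonneg: "\<And>m. m \<in> ?X \<Longrightarrow> x m \<ge> 0"
    and sym: "\<And>i j. 0 < i \<Longrightarrow> i < j \<Longrightarrow> j \<le> ?\<Delta> \<Longrightarrow>
        (\<Sum>m | m \<in> ?X \<and> size m = i. x m * int (count m j)) =
        (\<Sum>m | m \<in> ?X \<and> size m = j. x m * int (count m i))"
    and ev: "\<And>i. 1 \<le> i \<Longrightarrow> i \<le> ?\<Delta> \<Longrightarrow>
        (\<Sum>m | m \<in> ?X \<and> size m = i. x m * int (count m i)) = 2 * p i"
    using sol unfolding ip_solution_def Let_def by blast+
  have X_parts: "0 \<notin># m" if "m \<in> ?X" for m
    using that by (auto simp: bounded_partitions_def partition_of_def)
  let ?M = "{m \<in> ?X. m \<noteq> {#}}"
  have "(\<Sum>m | m \<in> ?M \<and> (size m, \<Sum>\<^sub># m) = y. nat (x m)) =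
      card {k \<in> ?V. (D ! k, F ! k) = y}" for y
  proof (cases y)
    case (Pair d f)
    show ?thesis
    proof (cases "d > 0 \<and> f > 0")
      case True
      have keys: "{m. m \<in> ?M \<and> (size m, \<Sum>\<^sub># m) = y} = {m. m \<in> ?X \<and> m \<stileturn> f \<and> size m = d}"
        using True X_parts by (auto simp: Pair partition_of_def)
      have "{k \<in> ?V. (D ! k, F ! k) = y} = {i. i < length D \<and> D ! i = d \<and> F ! i = f}"
        by (auto simp: Pair)
      then have vertices: "card {k \<in> ?V. (D ! k, F ! k) = y} = pair_count D F d f"
        unfolding pair_count_def by (rule arg_cong)
      have "int (\<Sum>m | m \<in> ?X \<and> m \<stileturn> f \<and> size m = d. nat (x m)) =
          (\<Sum>m | m \<in> ?X \<and> m \<stileturn> f \<and> size m = d. x m)"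
        using nonneg by simp
      also have "\<dots> = int (pair_count D F d f)" using total[of d f] True by blast
      finally show ?thesis unfolding keys vertices by (rule of_nat_eq_iff[THEN iffD1])
    next
      case False
      \<comment> \<open>A key with a zero component belongs neither to a vertex nor to a nonempty partition.\<close>
      have "{m. m \<in> ?M \<and> (size m, \<Sum>\<^sub># m) = y} = {}"
        using False X_parts by (force simp: Pair sum_mset_0_iff dest: multiset_nonemptyE)
      moreover have "{k \<in> ?V. (D ! k, F ! k) = y} = {}"
        using False pos by (auto simp: Pair)
      ultimately show ?thesis by (metis card.empty sum.empty)
    qed
  qed
  from exists_labelling_with_fibre_cards[OF _ _ this]
  obtain \<mu> where \<mu>: "\<And>k. k < length D \<Longrightarrow> \<mu> k \<in> ?M"
      "\<And>k. k < length D \<Longrightarrow> size (\<mu> k) = D ! k \<and> \<Sum>\<^sub># (\<mu> k) = F ! k"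
      "\<And>m. m \<in> ?M \<Longrightarrow> card {k \<in> ?V. \<mu> k = m} = nat (x m)"
    by (auto simp: finite_bounded_partitions)
  let ?h = "half_edges ((!) D) ?V \<mu>"
  have lin: "(\<Sum>m | m \<in> ?X \<and> size m = i. x m * int (count m j)) = int (?h i j)" if "i > 0" for i j
    using that \<mu> nonneg by (intro half_edges_eq_sum_partitions)
      (auto simp: finite_bounded_partitions)
  \<comment> \<open>The system only mentions colours between \<open>1\<close> and \<open>\<Delta>\<close>; no half-edge involves another one.\<close>
  have outside: "?h i j = 0 \<and> ?h j i = 0" if out: "\<not> (1 \<le> i \<and> i \<le> ?\<Delta>)" for i j
  proof -
    have "D ! k \<noteq> i" if "k < length D" for k
    proof -
      have "1 \<le> D ! k" "D ! k \<le> ?\<Delta>" using that pos(1) by (simp_all add: Suc_le_eq)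
      then show ?thesis using out by blast
    qed
    moreover have "count (\<mu> k) i = 0" if "k < length D" for k
      using \<mu>(1)[OF that] X_parts[of "\<mu> k"] out
      by (auto simp: bounded_partitions_def count_eq_zero_iff Suc_le_eq)
    ultimately show ?thesis by (auto simp: half_edges_def)
  qed
  have less: "?h i j = ?h j i" if "i < j" for i j
  proof (cases "0 < i \<and> j \<le> ?\<Delta>")
    case True
    then show ?thesis using sym[of i j] lin[of i j] lin[of j i] that by simp
  next
    case False
    then show ?thesis using outside[of i j] outside[of j i] that by (auto simp: Suc_le_eq)
  qed
  have "?h i j = ?h j i" for i j
    using less[of i j] less[of j i] by (cases i j rule: linorder_cases) auto
  moreover have "even (?h i i)" for i
  proof (cases "1 \<le> i \<and> i \<le> ?\<Delta>")
    case True
    then have "int (?h i i) = 2 * p i" using ev[of i] lin[of i i] by simp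
    then show ?thesis by presburger
  next
    case False
    then show ?thesis using outside[of i i] by simp
  qed
  ultimately have bal: "balanced ((!) D) ?V \<mu>" by (simp add: balanced_def)
  \<comment> \<open>By symmetry, a colour in demand is the colour of some vertex.\<close>
  have "j \<in> set D" if "k < length D" "j \<in># \<mu> k" for k j
  proof -
    have "?h (D ! k) j > 0" using that by (auto simp: half_edges_pos_iff)
    then have "?h j (D ! k) > 0" using bal by (simp add: balanced_def)
    then show ?thesis by (auto simp: half_edges_pos_iff)
  qed
  with \<mu>(2) bal show ?thesis by blast
qed

theorem theorem17:
  fixes D F :: "nat list"
  assumes "length D = length F"
    and "D \<noteq> []"
    and "\<forall>k < length D. D ! k > 0"
    and "\<forall>k < length F. F ! k > 0"
  shows "multigraph_realizable D F \<longleftrightarrow> (\<exists>x p. ip_solution D F x p)"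
proof -
  have F: "\<forall>k < length D. F ! k > 0" using assms(1,4) by simp
  show ?thesis
    unfolding multigraph_realizable_iff_balanced
    using balanced_imp_ip_solution[OF assms(3)] ip_solution_imp_balanced[OF assms(3) F] by blast
qed

end
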